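(* Let $\mu\in\mathbb{C}$, $t\in\mathbb{C}\setminus(-\infty,0]$, and let $r_N,\bar r_N$ ($N\ge 0$) be the reflection coefficients $r_N=(-1)^N I^{1}_N/I^0_N$, $\bar r_N=(-1)^N I^{-1}_N/I^0_N$ built from the Bessel Toeplitz determinants $I^{\epsilon}_N=\det[I_{\mu+\epsilon+j-k}(\sqrt t)]_{j,k=1,\dots,N}$, where it is assumed that $I^0_N\neq 0$ for all $N\ge 1$. Then for all $N\ge 1$ they satisfy the coupled recurrences $$\tfrac12\sqrt{t}\,(r_{N+1}\bar{r}_{N}+r_{N}\bar{r}_{N-1}) + N\frac{r_{N}\bar{r}_{N}}{1-r_{N}\bar{r}_{N}} - \mu = 0,$$ $$\tfrac12\sqrt{t}\,(\bar{r}_{N+1}r_{N}+\bar{r}_{N}r_{N-1}) + N\frac{r_{N}\bar{r}_{N}}{1-r_{N}\bar{r}_{N}} + \mu = 0,$$ with the initial conditions $$r_0=\bar r_0=1,\qquad r_1=-\frac{I_{\mu+1}(\sqrt t)}{I_\mu(\sqrt t)},\qquad \bar r_1=-\frac{I_{\mu-1}(\sqrt t)}{I_\mu(\sqrt t)}.$$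
   Context: $I_\alpha(x)$ denotes the modified Bessel function of the first kind (Bessel function of purely imaginary argument) of order $\alpha$, and $\sqrt t$ is the principal branch. For $\epsilon\in\{0,1,-1\}$ and $N\ge 0$ put $I^{\epsilon}_N:=\det[I_{\mu+\epsilon+j-k}(\sqrt t)]_{j,k=1,\dots,N}$, with $I^\epsilon_0:=1$ (for $\mu\in\mathbb{Z}$ these are the Toeplitz determinants of $z^{\epsilon}w(z)$, $w(z)=z^\mu e^{\frac12\sqrt t(z+1/z)}$ on the unit circle). The quantities $r_N$ and $\bar r_N$ are in general two independent quantities; the bar does not mean complex conjugation. One has $1-r_N\bar r_N=I^0_{N+1}I^0_{N-1}/(I^0_N)^2$ for $N\ge1$, which is nonzero under the stated assumption. *)

theory Defs
  imports "HOL-Analysis.Gamma_Function" "Jordan_Normal_Form.Determinant"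
begin

text \<open>
  The modified Bessel function of the first kind of complex order \<open>\<alpha>\<close>, on its principal branch:
  \<open>I\<^sub>\<alpha>(z) = (z/2)\<^sup>\<alpha> \<Sum>\<^sub>k (z\<^sup>2/4)\<^sup>k / (k! \<Gamma>(\<alpha>+k+1))\<close>.
  The entire function \<^const>\<open>rGamma\<close> is the reciprocal of \<open>\<Gamma>\<close>, so terms at poles of \<open>\<Gamma>\<close> vanish.
  The value at \<open>z = 0\<close> is always \<open>0\<close> because of the convention \<open>0 powr \<alpha> = 0\<close>;
  only \<open>z \<noteq> 0\<close> is meaningful.
\<close>

definition bessel_I :: "complex \<Rightarrow> complex \<Rightarrow> complex" where
  "bessel_I \<alpha> z =
     (z / 2) powr \<alpha> * (\<Sum>k. (z\<^sup>2 / 4) ^ k * rGamma (\<alpha> + of_nat k + 1) / fact k)"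

lemma summable_bessel_I:
  fixes \<alpha> z :: complex
  shows "summable (\<lambda>k. (z\<^sup>2 / 4) ^ k * rGamma (\<alpha> + of_nat k + 1) / fact k)"
proof -
  define f where "f = (\<lambda>k. (z\<^sup>2 / 4) ^ k * rGamma (\<alpha> + of_nat k + 1) / fact k)"
  define M where "M = nat \<lceil>norm \<alpha> + norm (z\<^sup>2 / 4) * 2\<rceil> + 1"
  have "norm (f (Suc n)) \<le> 1/2 * norm (f n)" if "n \<ge> M" for n
  proof -
    define w where "w = \<alpha> + of_nat n + 1"
    have "norm \<alpha> + norm (z\<^sup>2 / 4) * 2 \<le> real n"
      using that unfolding M_def by linarith
    moreover have "norm w \<ge> real n + 1 - norm \<alpha>"
    proof -
      have w: "of_nat (Suc n) - (- \<alpha>) = w"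
        by (simp add: w_def)
      show ?thesis
        using norm_triangle_ineq2[of "of_nat (Suc n)" "- \<alpha>", unfolded w]
        unfolding norm_of_nat norm_minus_cancel by simp
    qed
    ultimately have nw: "norm w \<ge> norm (z\<^sup>2 / 4) * 2 + 1"
      by linarith
    have "norm w > 0"
      using nw norm_ge_zero[of "z\<^sup>2 / 4"] by linarith
    then have w0: "w \<noteq> 0"
      by simp
    have "rGamma (\<alpha> + of_nat (Suc n) + 1) = rGamma w / w"
      using rGamma_plus1[of w] w0 by (simp add: w_def field_simps)
    moreover have "f n = (z\<^sup>2 / 4) ^ n * rGamma w / fact n"
      by (simp add: f_def w_def)
    ultimately have "f (Suc n) = f n * ((z\<^sup>2 / 4) / (of_nat (Suc n) * w))"
      unfolding f_def by (simp only: power_Suc fact_Suc times_divide_eq_left times_divide_eq_right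
        divide_divide_eq_left times_divide_times_eq mult_ac)
    moreover have "norm ((z\<^sup>2 / 4) / (of_nat (Suc n) * w)) \<le> 1/2"
    proof -
      have "norm (z\<^sup>2 / 4) * 2 \<le> 1 * norm w" using nw by linarith
      also have "\<dots> \<le> real (Suc n) * norm w" by (intro mult_right_mono) auto
      finally show ?thesis
        using w0 by (simp add: norm_divide norm_mult divide_simps mult_ac del: of_nat_Suc)
    qed
    ultimately show ?thesis
      using mult_left_mono[of "norm ((z\<^sup>2 / 4) / (of_nat (Suc n) * w))" "1/2" "norm (f n)"]
      by (simp only: norm_mult mult.commute[of "1/2"] norm_ge_zero)
  qed
  then show ?thesis
    using summable_ratio_test[of "1/2" M f] by (simp add: f_def)
qed

text \<open>
  Matrix indices run from \<open>0\<close> to \<open>N - 1\<close> rather than from \<open>1\<close> to \<open>N\<close>, which leaves the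
  difference \<open>j - k\<close> unchanged; the determinant of the empty matrix is \<open>1\<close>.
\<close>

definition bessel_toeplitz :: "complex \<Rightarrow> complex \<Rightarrow> int \<Rightarrow> nat \<Rightarrow> complex" where
  "bessel_toeplitz \<mu> t \<epsilon> N =
     Determinant.det (mat N N (\<lambda>(j, k).
       bessel_I (\<mu> + of_int \<epsilon> + of_nat j - of_nat k) (csqrt t)))"

definition refl_coeff :: "complex \<Rightarrow> complex \<Rightarrow> nat \<Rightarrow> complex" where
  "refl_coeff \<mu> t N = (-1) ^ N * bessel_toeplitz \<mu> t 1 N / bessel_toeplitz \<mu> t 0 N"

text \<open>The bar in \<open>refl_coeff_bar\<close> is notation, not complex conjugation.\<close>

definition refl_coeff_bar :: "complex \<Rightarrow> complex \<Rightarrow> nat \<Rightarrow> complex" where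
  "refl_coeff_bar \<mu> t N = (-1) ^ N * bessel_toeplitz \<mu> t (-1) N / bessel_toeplitz \<mu> t 0 N"

end

theory Submission
  imports Defs
begin

text \<open>
  Let \<open>L\<close> be the functional with \<open>L(z\<^sup>m) = c\<^sub>m = I\<^bsub>\<mu>+m\<^esub>(s)\<close>, \<open>s = \<surd>t\<close>. The Bessel recurrence
  \<open>s/2 (c\<^bsub>m-1\<^esub> - c\<^bsub>m+1\<^esub>) = (\<mu> + m) c\<^sub>m\<close> says
  \<open>L(z f' + (\<mu> + s/2 (z - 1/z)) f) = 0\<close> for every Laurent polynomial \<open>f\<close>.
  Let \<open>\<Phi>\<^sub>N(z)\<close> and \<open>\<Psi>\<^sub>N(1/z)\<close> be the monic biorthogonal polynomials, \<open>h\<^sub>N = L(\<Phi>\<^sub>N z\<^sup>-\<^sup>N)\<close>. Cofactor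
  expansion gives \<open>\<Phi>\<^sub>N(0) = r\<^sub>N\<close>, \<open>\<Psi>\<^sub>N(0)\<close> = rbar\<open>\<^sub>N\<close> and \<open>L(z \<Phi>\<^sub>N) = - r\<^bsub>N+1\<^esub> h\<^sub>N\<close>. The choice
  \<open>f = \<Phi>\<^sub>N(z) \<Psi>\<^sub>N(1/z)\<close> yields \<open>\<mu> = s/2 (r\<^bsub>N+1\<^esub>\<close> rbar\<open>\<^sub>N -\<close> rbar\<open>\<^bsub>N+1\<^esub> r\<^sub>N)\<close>, evaluating
  \<open>L(z \<Phi>\<^sub>N' z\<^bsup>1-N\<^esup> \<Phi>\<^bsub>N-1\<^esub>)\<close> in two ways yields
  \<open>s/2 (r\<^bsub>N+1\<^esub> + r\<^bsub>N-1\<^esub>) h\<^sub>N = - N r\<^sub>N h\<^bsub>N-1\<^esub>\<close>, and \<open>L(z \<Phi>\<^bsub>N-1\<^esub>(z) \<Psi>\<^sub>N(1/z))\<close> yields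
  \<open>h\<^sub>N = h\<^bsub>N-1\<^esub> (1 - r\<^sub>N\<close> rbar\<open>\<^sub>N)\<close>. The recurrences are combinations of these three relations.
\<close>

section \<open>Contiguous relation for the Bessel series\<close>

text \<open>The series of \<open>k * T \<alpha> k\<close> is summed twice: by the functional
  equation of \<open>rGamma\<close>, and after the index shift that cancels \<open>k\<close> against
  the factorial.\<close>

lemma bessel_I_recurrence:
  fixes \<alpha> z :: complex
  assumes "z \<noteq> 0"
  shows "z / 2 * (bessel_I (\<alpha> - 1) z - bessel_I (\<alpha> + 1) z) = \<alpha> * bessel_I \<alpha> z"
proof -
  define w where "w = z\<^sup>2 / 4"
  define T where "T \<beta> k = w ^ k * rGamma (\<beta> + of_nat k + 1) / fact k" for \<beta> :: complex and k
  have T: "summable (T \<beta>)" and I: "bessel_I \<beta> z = (z / 2) powr \<beta> * suminf (T \<beta>)" for \<beta>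
    using summable_bessel_I[of z \<beta>] by (simp_all add: T_def[abs_def] w_def bessel_I_def)
  have "T (\<alpha> - 1) k = (\<alpha> + of_nat k) * T \<alpha> k" for k
    using rGamma_plus1[of "\<alpha> + of_nat k"] by (simp add: T_def algebra_simps)
  then have eq: "of_nat k * T \<alpha> k = T (\<alpha> - 1) k - \<alpha> * T \<alpha> k" for k
    by (simp add: algebra_simps)
  have shift: "of_nat (Suc k) * T \<alpha> (Suc k) = w * T (\<alpha> + 1) k" for k
    by (simp add: T_def algebra_simps divide_simps del: of_nat_Suc) (simp add: algebra_simps)
  have "(\<lambda>k. of_nat (Suc k) * T \<alpha> (Suc k)) sums (w * suminf (T (\<alpha> + 1)))"
    unfolding shift by (intro sums_mult summable_sums T)
  then have "(\<lambda>k. of_nat k * T \<alpha> k) sums (w * suminf (T (\<alpha> + 1)))"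
    using sums_Suc_iff[of "\<lambda>k. of_nat k * T \<alpha> k"] by simp
  moreover have "(\<lambda>k. of_nat k * T \<alpha> k) sums (suminf (T (\<alpha> - 1)) - \<alpha> * suminf (T \<alpha>))"
    unfolding eq by (intro sums_diff sums_mult summable_sums T)
  ultimately have *: "suminf (T (\<alpha> - 1)) - \<alpha> * suminf (T \<alpha>) = w * suminf (T (\<alpha> + 1))"
    using sums_unique2 by blast
  have "z / 2 * (z / 2) powr (\<alpha> - 1) = (z / 2) powr \<alpha>"
    "z / 2 * (z / 2) powr (\<alpha> + 1) = (z / 2) powr \<alpha> * w"
    using assms by (simp_all add: powr_diff powr_add w_def power2_eq_square)
  then have "z / 2 * (bessel_I (\<alpha> - 1) z - bessel_I (\<alpha> + 1) z)
    = (z / 2) powr \<alpha> * suminf (T (\<alpha> - 1)) - (z / 2) powr \<alpha> * w * suminf (T (\<alpha> + 1))"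
    unfolding I by (metis mult.assoc right_diff_distrib)
  also have "\<dots> = (z / 2) powr \<alpha> * (suminf (T (\<alpha> - 1)) - w * suminf (T (\<alpha> + 1)))"
    by (simp add: algebra_simps)
  also have "\<dots> = \<alpha> * bessel_I \<alpha> z"
    unfolding *[symmetric] I by simp
  finally show ?thesis .
qed

section \<open>Toeplitz determinants and biorthogonal polynomials\<close>

definition toeplitz_det :: "(int \<Rightarrow> 'a::field) \<Rightarrow> nat \<Rightarrow> 'a" where
  "toeplitz_det c N = Determinant.det (mat N N (\<lambda>(j, k). c (int j - int k)))"

definition verblunsky :: "(int \<Rightarrow> 'a::field) \<Rightarrow> nat \<Rightarrow> 'a" where
  "verblunsky c N = (-1) ^ N * toeplitz_det (\<lambda>m. c (m + 1)) N / toeplitz_det c N"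

text \<open>Reflection transposes the Toeplitz matrices and swaps \<open>r\<close> with its barred
  partner, so one set of lemmas serves both.\<close>

definition reflect :: "(int \<Rightarrow> 'a) \<Rightarrow> int \<Rightarrow> 'a" where
  "reflect c m = c (- m)"

text \<open>The coefficient of \<open>z\<^sup>j\<close> in \<open>\<Phi>\<^sub>N\<close>, the values \<open>L(\<Phi>\<^sub>N z\<^sup>-\<^sup>k)\<close>, and \<open>h\<^sub>N\<close>.
  The polynomial \<open>\<Psi>\<^sub>N\<close> is obtained from the reflected sequence.\<close>

definition toeplitz_minor :: "(int \<Rightarrow> 'a::field) \<Rightarrow> nat \<Rightarrow> nat \<Rightarrow> 'a" where
  "toeplitz_minor c N j =
     Determinant.det (mat N N (\<lambda>(i, k). c (int (insert_index j i) - int k)))"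

definition orth_coeff :: "(int \<Rightarrow> 'a::field) \<Rightarrow> nat \<Rightarrow> nat \<Rightarrow> 'a" where
  "orth_coeff c N j = (-1) ^ (j + N) * toeplitz_minor c N j / toeplitz_det c N"

definition orth_moment :: "(int \<Rightarrow> 'a::field) \<Rightarrow> nat \<Rightarrow> int \<Rightarrow> 'a" where
  "orth_moment c N k = (\<Sum>j\<le>N. orth_coeff c N j * c (int j - k))"

definition orth_norm :: "(int \<Rightarrow> 'a::field) \<Rightarrow> nat \<Rightarrow> 'a" where
  "orth_norm c N = toeplitz_det c (Suc N) / toeplitz_det c N"

lemma reflect_reflect [simp]: "reflect (reflect c) = c"
  by (simp add: reflect_def fun_eq_iff)

lemma toeplitz_det_0 [simp]: "toeplitz_det c 0 = 1"
  by (simp add: toeplitz_det_def det_dim_zero)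

lemma verblunsky_0 [simp]: "verblunsky c 0 = 1"
  by (simp add: verblunsky_def)

lemma toeplitz_det_reflect [simp]: "toeplitz_det (reflect c) N = toeplitz_det c N"
proof -
  have "mat N N (\<lambda>(j, k). reflect c (int j - int k))
    = transpose_mat (mat N N (\<lambda>(j, k). c (int j - int k)))"
    by (rule eq_matI) (auto simp: reflect_def)
  then show ?thesis
    by (simp add: toeplitz_det_def det_transpose[of _ N])
qed

lemma orth_norm_reflect [simp]: "orth_norm (reflect c) N = orth_norm c N"
  by (simp add: orth_norm_def)

lemma orth_coeff_top:
  assumes "toeplitz_det c N \<noteq> 0"
  shows "orth_coeff c N N = 1"
proof -
  have "mat N N (\<lambda>(i, k). c (int (insert_index N i) - int k)) = mat N N (\<lambda>(j, k). c (int j - int k))"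
    by (rule eq_matI) auto
  then show ?thesis
    using assms by (simp add: orth_coeff_def toeplitz_minor_def toeplitz_det_def)
qed

lemma orth_coeff_bot: "orth_coeff c N 0 = verblunsky c N"
proof -
  have "mat N N (\<lambda>(i, k). c (int (insert_index 0 i) - int k))
    = mat N N (\<lambda>(j, k). c (int j - int k + 1))"
    by (rule eq_matI) (auto simp: algebra_simps)
  then show ?thesis
    by (simp add: orth_coeff_def toeplitz_minor_def verblunsky_def toeplitz_det_def)
qed

text \<open>Laplace expansion along the last column. Orthogonality thereby becomes a repeated
  column.\<close>

lemma orth_moment_det:
  "orth_moment c N k = Determinant.det (mat (Suc N) (Suc N)
     (\<lambda>(i, l). if l < N then c (int i - int l) else c (int i - k))) / toeplitz_det c N"
proof -
  define M where "M = mat (Suc N) (Suc N)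
     (\<lambda>(i, l). if l < N then c (int i - int l) else c (int i - k))"
  have "mat_delete M j N = mat N N (\<lambda>(i, k). c (int (insert_index j i) - int k))" if "j \<le> N" for j
    using that by (intro eq_matI) (auto simp: mat_delete_def M_def insert_index_def)
  then have "cofactor M j N = (-1) ^ (j + N) * toeplitz_minor c N j" if "j \<le> N" for j
    using that by (simp add: cofactor_def toeplitz_minor_def)
  moreover have "Determinant.det M = (\<Sum>j<Suc N. M $$ (j, N) * cofactor M j N)"
    by (rule laplace_expansion_column[where n = "Suc N"]) (auto simp: M_def)
  ultimately have "Determinant.det M
      = (\<Sum>j\<le>N. c (int j - k) * ((-1) ^ (j + N) * toeplitz_minor c N j))"
    unfolding lessThan_Suc_atMost by (auto simp: M_def intro!: sum.cong)
  then show ?thesis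
    unfolding M_def[symmetric]
    by (simp add: orth_moment_def orth_coeff_def sum_divide_distrib mult_ac)
qed

lemma orth_moment_less:
  assumes "0 \<le> k" "k < int N"
  shows "orth_moment c N k = 0"
proof -
  let ?M = "mat (Suc N) (Suc N)
     (\<lambda>(i, l). if l < N then c (int i - int l) else c (int i - k))"
  have "Determinant.det ?M = 0"
  proof (rule det_identical_columns[where n = "Suc N" and i = "nat k" and j = N])
    show "col ?M (nat k) = col ?M N"
      using assms by (intro eq_vecI) auto
  qed (use assms in auto)
  then show ?thesis
    by (simp add: orth_moment_det)
qed

lemma orth_moment_top: "orth_moment c N (int N) = orth_norm c N"
proof -
  have "mat (Suc N) (Suc N) (\<lambda>(i, l). if l < N then c (int i - int l) else c (int i - int N))
    = mat (Suc N) (Suc N) (\<lambda>(j, k). c (int j - int k))"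
    by (rule eq_matI) (auto simp: less_Suc_eq)
  then show ?thesis
    by (simp add: orth_moment_det orth_norm_def toeplitz_det_def)
qed

text \<open>The first column of the shifted Toeplitz matrix has the same minors as the column appended
  in \<^const>\<open>orth_moment\<close>.\<close>

lemma orth_moment_minus_1:
  assumes "toeplitz_det c (Suc N) \<noteq> 0"
  shows "orth_moment c N (-1) = - verblunsky c (Suc N) * orth_norm c N"
proof -
  define M where "M = mat (Suc N) (Suc N) (\<lambda>(j, k). c (int j - int k + 1))"
  have "mat_delete M j 0 = mat N N (\<lambda>(i, k). c (int (insert_index j i) - int k))" if "j \<le> N" for j
    using that by (intro eq_matI) (auto simp: mat_delete_def M_def insert_index_def algebra_simps)
  then have "cofactor M j 0 = (-1) ^ j * toeplitz_minor c N j" if "j \<le> N" for j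
    using that by (simp add: cofactor_def toeplitz_minor_def)
  moreover have "Determinant.det M = (\<Sum>j<Suc N. M $$ (j, 0) * cofactor M j 0)"
    by (rule laplace_expansion_column[where n = "Suc N"]) (auto simp: M_def)
  ultimately have "Determinant.det M
      = (\<Sum>j\<le>N. c (int j + 1) * ((-1) ^ j * toeplitz_minor c N j))"
    unfolding lessThan_Suc_atMost by (auto simp: M_def intro!: sum.cong)
  then have "toeplitz_det (\<lambda>m. c (m + 1)) (Suc N) / toeplitz_det c N
      = (-1) ^ N * orth_moment c N (-1)"
    by (simp add: toeplitz_det_def[of "\<lambda>m. c (m + 1)"] M_def orth_moment_def orth_coeff_def
        sum_divide_distrib sum_distrib_left power_add mult_ac flip: power_mult_distrib)
  then have "orth_moment c N (-1)
      = (-1) ^ N * (toeplitz_det (\<lambda>m. c (m + 1)) (Suc N) / toeplitz_det c N)"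
    by (simp flip: mult.assoc power_mult_distrib)
  then show ?thesis
    using assms by (simp add: verblunsky_def orth_norm_def)
qed

section \<open>Pairings of the two polynomial families\<close>

text \<open>Both sides expand
  \<open>L(z^(-d) \<Phi>\<^sub>n(z) \<Psi>\<^sub>m(1/z))\<close>.\<close>

lemma sum_orth_coeff_orth_moment_swap:
  "(\<Sum>k\<le>m. orth_coeff (reflect c) m k * orth_moment c n (int k + d))
     = (\<Sum>j\<le>n. orth_coeff c n j * orth_moment (reflect c) m (int j - d))"
  unfolding orth_moment_def sum_distrib_left
  by (subst sum.swap) (simp add: reflect_def algebra_simps)

lemma sum_mult_orth_moment:
  "(\<Sum>k\<le>N. f k * orth_moment c N (int k)) = f N * orth_norm c N"
  by (simp add: orth_moment_less orth_moment_top flip: lessThan_Suc_atMost)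

lemma sum_mult_orth_moment_pred:
  assumes "toeplitz_det c (Suc N) \<noteq> 0"
  shows "(\<Sum>k\<le>N. f k * orth_moment c N (int k - 1)) = - f 0 * verblunsky c (Suc N) * orth_norm c N"
  using assms by (simp add: sum.atMost_shift orth_moment_less orth_moment_minus_1 mult_ac)

text \<open>Both ends survive orthogonality: moment \<open>-1\<close> at \<open>k = 0\<close> and
  moment \<open>N\<close> at \<open>k = Suc N\<close>.\<close>

lemma sum_mult_orth_moment_pred_Suc:
  assumes "toeplitz_det c (Suc N) \<noteq> 0"
  shows "(\<Sum>k\<le>Suc N. f k * orth_moment c N (int k - 1))
    = (f (Suc N) - f 0 * verblunsky c (Suc N)) * orth_norm c N"
  using sum_mult_orth_moment_pred[OF assms, of f] orth_moment_top[of c N]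
  by (simp add: algebra_simps)

lemma orth_norm_Suc:
  assumes "\<And>N. toeplitz_det c N \<noteq> 0"
  shows "orth_norm c (Suc n)
    = orth_norm c n * (1 - verblunsky c (Suc n) * verblunsky (reflect c) (Suc n))"
proof -
  have "(\<Sum>k\<le>Suc n. orth_coeff (reflect c) (Suc n) k * orth_moment c n (int k - 1))
    = (1 - verblunsky (reflect c) (Suc n) * verblunsky c (Suc n)) * orth_norm c n"
    using assms by (simp add: sum_mult_orth_moment_pred_Suc orth_coeff_top orth_coeff_bot
        del: sum.atMost_Suc)
  moreover have "(\<Sum>j\<le>n. orth_coeff c n j * orth_moment (reflect c) (Suc n) (int j + 1))
    = orth_norm c (Suc n)"
    using orth_moment_top[of "reflect c" "Suc n"] orth_coeff_top[of c n] assms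
    by (simp add: orth_moment_less add.commute flip: lessThan_Suc_atMost)
  ultimately show ?thesis
    using sum_orth_coeff_orth_moment_swap[of c "Suc n" n "-1"] by (simp add: mult_ac)
qed

text \<open>The moments \<open>L(z \<Phi>\<^sub>N' z\<^sup>-\<^sup>k)\<close>.\<close>

lemma deriv_moment:
  fixes a \<mu> :: "'a::field"
  assumes "\<And>m. a * (c (m - 1) - c (m + 1)) = (\<mu> + of_int m) * c m"
  shows "(\<Sum>j\<le>N. of_nat j * orth_coeff c N j * c (int j - k))
    = a * (orth_moment c N (k + 1) - orth_moment c N (k - 1)) - (\<mu> - of_int k) * orth_moment c N k"
proof -
  have "of_nat j * orth_coeff c N j * c (int j - k)
    = a * (orth_coeff c N j * c (int j - (k + 1)) - orth_coeff c N j * c (int j - (k - 1)))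
      - (\<mu> - of_int k) * (orth_coeff c N j * c (int j - k))" for j
  proof -
    have "a * (c (int j - (k + 1)) - c (int j - (k - 1))) = (\<mu> + of_nat j - of_int k) * c (int j - k)"
      using assms[of "int j - k"] by (simp add: algebra_simps)
    then have "orth_coeff c N j * (a * (c (int j - (k + 1)) - c (int j - (k - 1))))
      = orth_coeff c N j * ((\<mu> + of_nat j - of_int k) * c (int j - k))"
      by simp
    then show ?thesis
      by (simp add: algebra_simps)
  qed
  then show ?thesis
    unfolding orth_moment_def sum_distrib_left sum_subtractf[symmetric] by simp
qed

section \<open>Relations forced by the Bessel recurrence\<close>

lemma verblunsky_wronskian:
  fixes a \<mu> :: "'a::field"
  assumes nz: "\<And>N. toeplitz_det c N \<noteq> 0"
    and c: "\<And>m. a * (c (m - 1) - c (m + 1)) = (\<mu> + of_int m) * c m"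
  shows "a * (verblunsky c (Suc N) * verblunsky (reflect c) N
    - verblunsky (reflect c) (Suc N) * verblunsky c N) = \<mu>"
proof -
  let ?\<phi> = "orth_coeff c N" and ?\<psi> = "orth_coeff (reflect c) N" and ?h = "orth_norm c N"
  have "(\<Sum>k\<le>N. ?\<psi> k * (\<Sum>j\<le>N. of_nat j * ?\<phi> j * c (int j - int k)))
    = (\<Sum>j\<le>N. of_nat j * ?\<phi> j * orth_moment (reflect c) N (int j))"
    unfolding orth_moment_def sum_distrib_left
    by (subst sum.swap) (simp add: reflect_def mult_ac)
  \<comment> \<open>Only \<open>j = N\<close> survives, where the derivative of the monic
    \<open>\<Phi>\<^sub>N\<close> brings down \<open>N\<close>.\<close>
  also have "\<dots> = of_nat N * ?h"
    by (simp add: sum_mult_orth_moment orth_coeff_top nz)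
  finally have "of_nat N * ?h
    = (\<Sum>k\<le>N. a * (?\<psi> k * orth_moment c N (int k + 1)) - a * (?\<psi> k * orth_moment c N (int k - 1))
        - (\<mu> - of_nat k) * ?\<psi> k * orth_moment c N (int k))"
    by (simp only: deriv_moment[OF c]) (simp add: algebra_simps)
  \<comment> \<open>The weight \<open>\<mu> - k\<close> counts only at \<open>k = N\<close>; its
    \<open>N\<close> later cancels the left-hand side.\<close>
  also have "\<dots> = a * (\<Sum>k\<le>N. ?\<psi> k * orth_moment c N (int k + 1))
      - a * (\<Sum>k\<le>N. ?\<psi> k * orth_moment c N (int k - 1)) - (\<mu> - of_nat N) * ?h"
    by (simp add: sum_subtractf sum_mult_orth_moment orth_coeff_top nz flip: sum_distrib_left)
  \<comment> \<open>Exchanging the two families turns the shift \<open>+1\<close> into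
    \<open>-1\<close>, which yields the boundary term of \<open>reflect c\<close>.\<close>
  also have "(\<Sum>k\<le>N. ?\<psi> k * orth_moment c N (int k + 1))
      = - verblunsky c N * verblunsky (reflect c) (Suc N) * ?h"
    by (simp add: sum_orth_coeff_orth_moment_swap sum_mult_orth_moment_pred orth_coeff_bot nz)
  also have "(\<Sum>k\<le>N. ?\<psi> k * orth_moment c N (int k - 1))
      = - verblunsky (reflect c) N * verblunsky c (Suc N) * ?h"
    by (simp add: sum_mult_orth_moment_pred orth_coeff_bot nz)
  finally have "(a * (verblunsky c (Suc N) * verblunsky (reflect c) N
    - verblunsky (reflect c) (Suc N) * verblunsky c N)) * ?h = \<mu> * ?h"
    by (simp add: algebra_simps)
  moreover have "?h \<noteq> 0"
    by (simp add: orth_norm_def nz)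
  ultimately show ?thesis
    by simp
qed

text \<open>Both paired factors come from the \<open>\<Phi>\<close> family, so no barred coefficient
  enters.\<close>

lemma verblunsky_three_term:
  fixes a \<mu> :: "'a::field"
  assumes nz: "\<And>N. toeplitz_det c N \<noteq> 0"
    and c: "\<And>m. a * (c (m - 1) - c (m + 1)) = (\<mu> + of_int m) * c m"
  shows "a * (verblunsky c (Suc (Suc n)) + verblunsky c n) * orth_norm c (Suc n)
    = - of_nat (Suc n) * verblunsky c (Suc n) * orth_norm c n"
proof -
  let ?\<phi> = "orth_coeff c (Suc n)" and ?\<chi> = "orth_coeff c n" and ?M = "orth_moment c (Suc n)"
  have "(\<Sum>i\<le>n. ?\<chi> i * (\<Sum>j\<le>Suc n. of_nat j * ?\<phi> j * c (int j - (int n - int i))))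
    = (\<Sum>j\<le>Suc n. of_nat j * ?\<phi> j * orth_moment c n (int n - int j))"
    unfolding orth_moment_def sum_distrib_left
    by (subst sum.swap) (simp add: algebra_simps del: sum.atMost_Suc)
  also have "\<dots> = (\<Sum>j\<le>n. of_nat j * ?\<phi> j * orth_moment c n (int n - int j))
      - of_nat (Suc n) * verblunsky c (Suc n) * orth_norm c n"
    by (simp add: orth_coeff_top orth_moment_minus_1 nz algebra_simps)
  \<comment> \<open>At \<open>j = 0\<close> the moment is \<open>orth_norm c n\<close>, but the
    factor \<open>j\<close> kills it; the others vanish by orthogonality.\<close>
  also have "(\<Sum>j\<le>n. of_nat j * ?\<phi> j * orth_moment c n (int n - int j)) = 0"
  proof (intro sum.neutral ballI)
    show "of_nat j * ?\<phi> j * orth_moment c n (int n - int j) = 0" if "j \<in> {..n}" for j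
      using that by (cases "j = 0") (auto simp: orth_moment_less)
  qed
  finally have "- of_nat (Suc n) * verblunsky c (Suc n) * orth_norm c n
    = (\<Sum>i\<le>n. ?\<chi> i * (a * (?M (int n - int i + 1) - ?M (int n - int i - 1))
        - (\<mu> - of_int (int n - int i)) * ?M (int n - int i)))"
    by (simp only: deriv_moment[OF c] mult_minus_left diff_0)
  \<comment> \<open>The index \<open>n - i\<close> stays within \<open>0..n\<close>, below the
    degree \<open>Suc n\<close>, so the \<open>\<mu>\<close> terms drop out.\<close>
  also have "\<dots> = (\<Sum>i\<le>n. a * (?\<chi> i * ?M (int n - int i + 1))
      - a * (?\<chi> i * ?M (int n - int i - 1)))"
    by (intro sum.cong) (auto simp: orth_moment_less algebra_simps)
  also have "\<dots> = a * (\<Sum>i\<le>n. ?\<chi> i * ?M (int n - int i + 1))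
      - a * (\<Sum>i\<le>n. ?\<chi> i * ?M (int n - int i - 1))"
    by (simp add: sum_subtractf sum_distrib_left)
  also have "(\<Sum>i\<le>n. ?\<chi> i * ?M (int n - int i + 1)) = verblunsky c n * orth_norm c (Suc n)"
    using orth_moment_top[of c "Suc n"]
    by (simp add: sum.atMost_shift orth_moment_less orth_coeff_bot add.commute)
  also have "(\<Sum>i\<le>n. ?\<chi> i * ?M (int n - int i - 1))
      = - verblunsky c (Suc (Suc n)) * orth_norm c (Suc n)"
    by (simp add: orth_moment_less orth_moment_minus_1 orth_coeff_top nz
        flip: lessThan_Suc_atMost)
  finally show ?thesis
    by (simp add: algebra_simps)
qed

lemma verblunsky_coupled_recurrence:
  fixes a \<mu> :: "'a::field"
  assumes nz: "\<And>N. toeplitz_det c N \<noteq> 0"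
    and c: "\<And>m. a * (c (m - 1) - c (m + 1)) = (\<mu> + of_int m) * c m"
    and "N \<ge> 1"
  defines "r \<equiv> verblunsky c" and "q \<equiv> verblunsky (reflect c)"
  shows "a * (r (N + 1) * q N + r N * q (N - 1)) + of_nat N * (r N * q N / (1 - r N * q N)) - \<mu> = 0"
proof -
  obtain n where N: "N = Suc n"
    using \<open>N \<ge> 1\<close> by (cases N) auto
  define h where "h = orth_norm c n"
  have h: "h \<noteq> 0" "orth_norm c (Suc n) \<noteq> 0"
    by (simp_all add: h_def orth_norm_def nz)
  have hN: "orth_norm c (Suc n) = h * (1 - r N * q N)"
    using orth_norm_Suc[of c n] nz by (simp add: h_def r_def q_def N)
  with h have D: "1 - r N * q N \<noteq> 0"
    by auto
  \<comment> \<open>The Wronskian at \<open>N - 1\<close> trades \<open>r N * q (N - 1)\<close> for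
    \<open>q N * r (N - 1)\<close>, so that the three-term relation times \<open>q N\<close>
    applies.\<close>
  have W: "a * (r N * q n) = \<mu> + a * (q N * r n)"
    using verblunsky_wronskian[OF nz c, of n] by (simp add: r_def q_def N algebra_simps)
  have "(a * (r (Suc N) + r n) * (1 - r N * q N)) * h = (- of_nat N * r N) * h"
    using verblunsky_three_term[OF nz c, of n]
    unfolding hN h_def[symmetric] r_def[symmetric]
    by (simp add: N mult_ac)
  then have "a * (r (Suc N) + r n) * (1 - r N * q N) = - of_nat N * r N"
    using h(1) by (rule mult_right_cancel[THEN iffD1, rotated])
  then have "a * (r (Suc N) + r n) = - of_nat N * r N / (1 - r N * q N)"
    using D by (rule nonzero_eq_divide_eq[THEN iffD2, rotated])
  then have T: "a * (r (Suc N) + r n) * q N = - (of_nat N * (r N * q N / (1 - r N * q N)))"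
    by simp
  have "a * (r (N + 1) * q N + r N * q (N - 1)) = a * (r (Suc N) + r n) * q N + \<mu>"
    using W by (simp add: N algebra_simps)
  then show ?thesis
    unfolding T by simp
qed

theorem proposition3p1:
  fixes \<mu> t :: complex and r rbar :: "nat \<Rightarrow> complex"
  defines "r \<equiv> refl_coeff \<mu> t" and "rbar \<equiv> refl_coeff_bar \<mu> t"
  assumes "t \<notin> \<real>\<^sub>\<le>\<^sub>0"
    and "\<And>N. N \<ge> 1 \<Longrightarrow> bessel_toeplitz \<mu> t 0 N \<noteq> 0"
  shows "(\<forall>N\<ge>1.
            csqrt t / 2 * (r (N + 1) * rbar N + r N * rbar (N - 1))
              + of_nat N * (r N * rbar N / (1 - r N * rbar N)) - \<mu> = 0
          \<and> csqrt t / 2 * (rbar (N + 1) * r N + rbar N * r (N - 1))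
              + of_nat N * (r N * rbar N / (1 - r N * rbar N)) + \<mu> = 0)
       \<and> r 0 = 1 \<and> rbar 0 = 1
       \<and> r 1 = - (bessel_I (\<mu> + 1) (csqrt t) / bessel_I \<mu> (csqrt t))
       \<and> rbar 1 = - (bessel_I (\<mu> - 1) (csqrt t) / bessel_I \<mu> (csqrt t))"
proof -
  define c where "c m = bessel_I (\<mu> + of_int m) (csqrt t)" for m :: int
  have shifted: "bessel_toeplitz \<mu> t e N = toeplitz_det (\<lambda>m. c (m + e)) N" for e N
    by (simp add: bessel_toeplitz_def toeplitz_det_def c_def algebra_simps)
  have nz: "toeplitz_det c N \<noteq> 0" for N
    using assms(4)[of N] shifted[of 0 N] by (cases "N = 0") auto
  have r: "r = verblunsky c"
    by (simp add: r_def refl_coeff_def verblunsky_def shifted fun_eq_iff)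
  have "toeplitz_det (\<lambda>m. reflect c (m + 1)) N = bessel_toeplitz \<mu> t (-1) N" for N
    using toeplitz_det_reflect[of "\<lambda>m. c (m - 1)" N] by (simp add: shifted reflect_def[abs_def])
  then have rbar: "rbar = verblunsky (reflect c)"
    using shifted[of 0] by (simp add: rbar_def refl_coeff_bar_def verblunsky_def fun_eq_iff)
  have "csqrt t \<noteq> 0"
    using assms(3) by auto
  then have rec: "csqrt t / 2 * (c (m - 1) - c (m + 1)) = (\<mu> + of_int m) * c m" for m
    using bessel_I_recurrence[of "csqrt t" "\<mu> + of_int m"] by (simp add: c_def algebra_simps)
  \<comment> \<open>Reflection sends \<open>\<mu>\<close> to \<open>- \<mu>\<close>; the second
    recurrence is thus the first one for \<open>reflect c\<close>.\<close>
  have rec': "csqrt t / 2 * (reflect c (m - 1) - reflect c (m + 1))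
      = (- \<mu> + of_int m) * reflect c m" for m
  proof -
    have "- m - 1 = - (m + 1)" "- m + 1 = - (m - 1)"
      by simp_all
    then show ?thesis
      using rec[of "- m"] by (simp only: reflect_def of_int_minus) (simp add: algebra_simps)
  qed
  have det1: "toeplitz_det d 1 = d 0" for d :: "int \<Rightarrow> complex"
    by (simp add: toeplitz_det_def det_single)
  have "r 1 = - (bessel_I (\<mu> + 1) (csqrt t) / bessel_I \<mu> (csqrt t))"
    unfolding r verblunsky_def det1 by (simp add: c_def)
  moreover have "rbar 1 = - (bessel_I (\<mu> - 1) (csqrt t) / bessel_I \<mu> (csqrt t))"
    unfolding rbar verblunsky_def det1 by (simp add: c_def reflect_def)
  moreover have "csqrt t / 2 * (r (N + 1) * rbar N + r N * rbar (N - 1))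
      + of_nat N * (r N * rbar N / (1 - r N * rbar N)) - \<mu> = 0" if "N \<ge> 1" for N
    using verblunsky_coupled_recurrence[OF nz rec that] by (simp add: r rbar)
  moreover have "csqrt t / 2 * (rbar (N + 1) * r N + rbar N * r (N - 1))
      + of_nat N * (r N * rbar N / (1 - r N * rbar N)) + \<mu> = 0" if "N \<ge> 1" for N
    using verblunsky_coupled_recurrence[of "reflect c", OF _ rec' that] nz
    by (simp add: r rbar mult.commute)
  ultimately show ?thesis
    by (simp add: r rbar)
qed

end
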